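(* Let $f$ be a holomorphic self-map of the open unit disc $\mathbb{D}$ with a Denjoy--Wolff point $\zeta$ on the boundary of $\mathbb{D}$. Then there exist neighbourhoods $\mathcal{U}_1,\mathcal{U}_2,\dotsc$ of $f$ in $\mathcal{H}(\mathbb{D})$ such that if $f_n\in\mathcal{U}_n$, for $n=1,2,\dotsc$, then the left-composition sequence $F_n=f_n\circ f_{n-1}\circ\dotsb\circ f_1$, $n=1,2,\dotsc$, converges locally uniformly on $\mathbb{D}$ to $\zeta$.
   Context: $\mathbb{D}=\{z\in\mathbb{C}:|z|<1\}$. $\mathcal{H}(\mathbb{D})$ denotes the set of all holomorphic self-maps of $\mathbb{D}$ (holomorphic functions $\mathbb{D}\to\mathbb{D}$), with the subspace topology inherited from the space of all holomorphic maps $\mathbb{D}\to\mathbb{C}$ equipped with the compact-open topology (the topology of uniform convergence on compact subsets of $\mathbb{D}$). A holomorphic self-map $f$ of $\mathbb{D}$ has Denjoy--Wolff point $\zeta\in\overline{\mathbb{D}}$ if the sequence of iterates $f,f^2,f^3,\dotsc$ (where $f^n$ is the $n$-fold composition of $f$ with itself) converges locally uniformly on $\mathbb{D}$ to the constant $\zeta$. By the Denjoy--Wolff theorem, every holomorphic self-map of $\mathbb{D}$ other than the identity and the elliptic Möbius transformations fixing $\mathbb{D}$ (automorphisms of $\mathbb{D}$ conjugate by an automorphism of $\mathbb{D}$ to a rotation about $0$) has a Denjoy--Wolff point. Locally uniform convergence on $\mathbb{D}$ means uniform convergence on compact subsets of $\mathbb{D}$ with respect to the Euclidean metric on $\overline{\mathbb{D}}$;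 convergence to $\zeta$ means convergence to the constant function with value $\zeta$. *)

theory Defs
  imports "HOL-Analysis.Analysis"
begin

abbreviation unit_disc :: "complex set" where
  "unit_disc \<equiv> ball 0 1"

(* Partial functions with domain S are represented, as in HOL-Library.FuncSet, by total
   functions that are undefined outside S. This makes the correspondence one-to-one, so the
   topologies below live on the genuine sets of functions. *)

definition compact_open_topology :: "'a topology \<Rightarrow> 'b topology \<Rightarrow> ('a \<Rightarrow> 'b) topology" where
  "compact_open_topology X Y = topology_generated_by
     {{f \<in> extensional (topspace X). continuous_map X Y f \<and> f ` K \<subseteq> V} | K V.
        compactin X K \<and> openin Y V}"

definition hol_self_maps :: "(complex \<Rightarrow> complex) set" where
  "hol_self_maps =
     {f \<in> unit_disc \<rightarrow>\<^sub>E unit_disc. f holomorphic_on unit_disc}"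

(* The compact-open topology on all holomorphic functions on the disc is itself the subspace
   topology from the continuous functions, so the intermediate space is omitted. *)
definition hol_self_map_topology :: "(complex \<Rightarrow> complex) topology" where
  "hol_self_map_topology =
     subtopology (compact_open_topology (top_of_set unit_disc) euclidean) hol_self_maps"

(* Neighbourhoods are not required to be open. *)
definition is_neighbourhood :: "'a topology \<Rightarrow> 'a \<Rightarrow> 'a set \<Rightarrow> bool" where
  "is_neighbourhood X x U \<longleftrightarrow>
     U \<subseteq> topspace X \<and> (\<exists>V. openin X V \<and> x \<in> V \<and> V \<subseteq> U)"

definition converges_loc_unif_on_disc :: "(nat \<Rightarrow> complex \<Rightarrow> complex) \<Rightarrow> complex \<Rightarrow> bool" where
  "converges_loc_unif_on_disc F \<zeta> \<longleftrightarrow>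
     (\<forall>K. compact K \<and> K \<subseteq> unit_disc \<longrightarrow> uniform_limit K F (\<lambda>_. \<zeta>) sequentially)"

definition denjoy_wolff_point :: "(complex \<Rightarrow> complex) \<Rightarrow> complex \<Rightarrow> bool" where
  "denjoy_wolff_point f \<zeta> \<longleftrightarrow>
     \<zeta> \<in> cball 0 1 \<and> converges_loc_unif_on_disc (\<lambda>n. f ^^ n) \<zeta>"

(* left_comp f n = f n \<circ> ... \<circ> f 1; the value f 0 is not used. *)
primrec left_comp :: "(nat \<Rightarrow> 'a \<Rightarrow> 'a) \<Rightarrow> nat \<Rightarrow> 'a \<Rightarrow> 'a" where
  "left_comp f 0 = id"
| "left_comp f (Suc n) = f (Suc n) \<circ> left_comp f n"

lemma topspace_compact_open_topology:
  "topspace (compact_open_topology X Y) = {f \<in> extensional (topspace X). continuous_map X Y f}"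
    (is "_ = ?C")
proof
  show "topspace (compact_open_topology X Y) \<subseteq> ?C"
    unfolding compact_open_topology_def topology_generated_by_topspace by blast
  have "compactin X {}" "openin Y {}" by simp_all
  then have "{f \<in> extensional (topspace X). continuous_map X Y f \<and> f ` {} \<subseteq> {}}
      \<in> {{f \<in> extensional (topspace X). continuous_map X Y f \<and> f ` K \<subseteq> V} | K V.
            compactin X K \<and> openin Y V}"
    by blast
  then have "{f \<in> extensional (topspace X). continuous_map X Y f \<and> f ` {} \<subseteq> {}}
      \<subseteq> topspace (compact_open_topology X Y)"
    unfolding compact_open_topology_def topology_generated_by_topspace by (rule Union_upper)
  then show "?C \<subseteq> topspace (compact_open_topology X Y)" by simp
qed

lemma topspace_hol_self_map_topology: "topspace hol_self_map_topology = hol_self_maps"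
proof -
  have "hol_self_maps \<subseteq> topspace (compact_open_topology (top_of_set unit_disc) euclidean)"
    unfolding topspace_compact_open_topology hol_self_maps_def PiE_def
    using holomorphic_on_imp_continuous_on by fastforce
  then show ?thesis
    unfolding hol_self_map_topology_def topspace_subtopology by (rule Int_absorb1)
qed

end

theory Submission
  imports Defs "HOL-Complex_Analysis.Riemann_Mapping"
begin

text \<open>
  Measure distances in the disc by the pseudohyperbolic distance
  \<open>d(w, z) = \<bar>(z - w) / (1 - cnj w z)\<bar>\<close>. By the Schwarz--Pick lemma every holomorphic self-map of the
  disc is nonexpanding for \<open>d\<close> (\<open>Schwarz_Pick\<close>). Write \<open>p\<^sub>n = f\<^sup>n(0)\<close> and choose strictly increasing
  radii \<open>r\<^sub>n\<close>, starting at \<open>0\<close> and staying below \<open>1/2\<close>. Since \<open>f\<close> is nonexpanding, it maps the closed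
  \<open>d\<close>-ball of radius \<open>r\<^sub>n\<close> about \<open>p\<^sub>n\<close> into the closed ball of the same radius about \<open>p\<^sub>n\<^sub>+\<^sub>1\<close>, hence into
  the open ball of the larger radius \<open>r\<^sub>n\<^sub>+\<^sub>1\<close>. The former ball is compact and the latter is open, so the
  self-maps with this mapping property form a subbasic open set of the compact-open topology
  (\<open>is_neighbourhood_hol_self_map_topology\<close>): this is the neighbourhood \<open>U\<^sub>n\<^sub>+\<^sub>1\<close>.

  If each \<open>f\<^sub>n\<close> lies in \<open>U\<^sub>n\<close>, then by construction \<open>F\<^sub>n(0)\<close> stays in the \<open>d\<close>-ball of radius \<open>1/2\<close> about
  \<open>p\<^sub>n\<close>. Near the unit circle \<open>d\<close>-balls of a fixed radius less than \<open>1\<close> are small in the Euclidean sense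
  (\<open>uniform_limit_if_pseudohyperbolically_close\<close>), and \<open>p\<^sub>n\<close> tends to the boundary point \<open>\<zeta>\<close>; therefore
  \<open>F\<^sub>n(0)\<close> tends to \<open>\<zeta>\<close>. The same principle carries the convergence over from \<open>0\<close> to any compact set: the
  composition \<open>F\<^sub>n\<close> is nonexpanding too, so \<open>d(F\<^sub>n(0), F\<^sub>n(z)) \<le> d(0, z) = \<bar>z\<bar>\<close>, which is bounded away
  from \<open>1\<close> on compact sets.
\<close>

section \<open>Pseudohyperbolic distance and the Schwarz--Pick lemma\<close>

definition pseudohyperbolic_dist :: "complex \<Rightarrow> complex \<Rightarrow> real" where
  "pseudohyperbolic_dist w z = norm (Moebius_function 0 w z)"

lemma one_minus_cnj_mult_nonzero:
  assumes "w \<in> unit_disc" "z \<in> unit_disc"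
  shows "1 - cnj w * z \<noteq> 0"
proof
  assume "1 - cnj w * z = 0"
  then have "norm w * norm z = 1"
    by (metis complex_mod_cnj eq_iff_diff_eq_0 norm_mult norm_one)
  moreover have "norm w * norm z < 1 * 1"
    using assms by (intro mult_strict_mono') auto
  ultimately show False by simp
qed

lemma norm_diff_eq_pseudohyperbolic_dist:
  assumes "w \<in> unit_disc" "z \<in> unit_disc"
  shows "norm (z - w) = pseudohyperbolic_dist w z * norm (1 - cnj w * z)"
  using one_minus_cnj_mult_nonzero[OF assms]
  by (simp add: pseudohyperbolic_dist_def Moebius_function_simple norm_divide)

lemma norm_one_minus_cnj_mult_sq:
  "(norm (1 - cnj w * z))\<^sup>2 = (norm (z - w))\<^sup>2 + (1 - (norm w)\<^sup>2) * (1 - (norm z)\<^sup>2)"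
  unfolding cmod_power2 by (simp add: power2_eq_square algebra_simps)

text \<open>
  Conjugating by Moebius functions that take \<open>w\<close> and \<open>h w\<close> to the origin reduces this to the
  Schwarz lemma.
\<close>

lemma Schwarz_Pick:
  assumes hol: "h holomorphic_on unit_disc" and self: "h \<in> unit_disc \<rightarrow> unit_disc"
    and w: "w \<in> unit_disc" and z: "z \<in> unit_disc"
  shows "pseudohyperbolic_dist (h w) (h z) \<le> pseudohyperbolic_dist w z"
proof -
  define k where "k = Moebius_function 0 (h w) \<circ> h \<circ> Moebius_function 0 (-w)"
  have hw: "h w \<in> unit_disc" using self w by auto
  have M: "Moebius_function 0 (-w) \<in> unit_disc \<rightarrow> unit_disc"
    using w Moebius_function_norm_lt_1 by auto
  have "k holomorphic_on unit_disc"
    unfolding k_def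
  proof (intro holomorphic_on_compose_gen[of _ "unit_disc" _ "unit_disc"])
    show "Moebius_function 0 (-w) holomorphic_on unit_disc"
      "Moebius_function 0 (h w) holomorphic_on unit_disc"
      using w hw by (auto intro!: Moebius_function_holomorphic)
  qed (use hol self M in auto)
  moreover have "k 0 = 0"
    by (simp add: k_def Moebius_function_of_zero Moebius_function_eq_zero)
  moreover have "norm (k x) < 1" if "norm x < 1" for x
    unfolding k_def o_def using that M self hw
    by (intro Moebius_function_norm_lt_1) (auto simp: Pi_iff)
  moreover have "norm (Moebius_function 0 w z) < 1"
    using w z by (intro Moebius_function_norm_lt_1) auto
  ultimately have "norm (k (Moebius_function 0 w z)) \<le> norm (Moebius_function 0 w z)"
    by (rule Schwarz_Lemma(1))
  moreover have "k (Moebius_function 0 w z) = Moebius_function 0 (h w) (h z)"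
    using w z by (simp add: k_def Moebius_function_compose)
  ultimately show ?thesis by (simp add: pseudohyperbolic_dist_def)
qed

section \<open>Pseudohyperbolic balls\<close>

definition pseudohyperbolic_ball :: "complex \<Rightarrow> real \<Rightarrow> complex set" where
  "pseudohyperbolic_ball w r = {z \<in> unit_disc. pseudohyperbolic_dist w z < r}"

definition pseudohyperbolic_cball :: "complex \<Rightarrow> real \<Rightarrow> complex set" where
  "pseudohyperbolic_cball w r = {z \<in> unit_disc. pseudohyperbolic_dist w z \<le> r}"

lemma open_pseudohyperbolic_ball:
  assumes "w \<in> unit_disc"
  shows "open (pseudohyperbolic_ball w r)"
proof -
  have "continuous_on unit_disc (Moebius_function 0 w)"
    using assms by (intro holomorphic_on_imp_continuous_on Moebius_function_holomorphic) auto
  then have "open (unit_disc \<inter> Moebius_function 0 w -` ball 0 r)"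
    by (intro continuous_open_preimage) auto
  also have "unit_disc \<inter> Moebius_function 0 w -` ball 0 r = pseudohyperbolic_ball w r"
    by (auto simp: pseudohyperbolic_ball_def pseudohyperbolic_dist_def)
  finally show ?thesis .
qed

text \<open>
  The ball is the image of the Euclidean ball \<open>cball 0 r\<close> under a Moebius function.
\<close>

lemma compact_pseudohyperbolic_cball:
  assumes w: "w \<in> unit_disc" and r: "r < 1"
  shows "compact (pseudohyperbolic_cball w r)"
proof -
  have sub: "cball 0 r \<subseteq> unit_disc" using r by auto
  have "Moebius_function 0 (-w) holomorphic_on unit_disc"
    using w by (intro Moebius_function_holomorphic) auto
  then have "continuous_on (cball 0 r) (Moebius_function 0 (-w))"
    using sub by (meson continuous_on_subset holomorphic_on_imp_continuous_on)
  then have "compact (Moebius_function 0 (-w) ` cball 0 r)"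
    by (intro compact_continuous_image) auto
  also have "Moebius_function 0 (-w) ` cball 0 r = pseudohyperbolic_cball w r"
  proof (intro subset_antisym subsetI)
    fix y assume "y \<in> Moebius_function 0 (-w) ` cball 0 r"
    then obtain x where x: "norm x \<le> r" "y = Moebius_function 0 (-w) x" by auto
    then have "norm y < 1" "Moebius_function 0 w y = x"
      using r w Moebius_function_norm_lt_1[of "-w" x]
      by (auto intro!: Moebius_function_compose)
    then show "y \<in> pseudohyperbolic_cball w r"
      using x by (simp add: pseudohyperbolic_cball_def pseudohyperbolic_dist_def)
  next
    fix y assume "y \<in> pseudohyperbolic_cball w r"
    then have "norm y < 1" "Moebius_function 0 w y \<in> cball 0 r"
      by (auto simp: pseudohyperbolic_cball_def pseudohyperbolic_dist_def)
    moreover have "y = Moebius_function 0 (-w) (Moebius_function 0 w y)"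
      using w \<open>norm y < 1\<close> by (simp add: Moebius_function_compose)
    ultimately show "y \<in> Moebius_function 0 (-w) ` cball 0 r" by blast
  qed
  finally show ?thesis .
qed

text \<open>
  Quantifies how \<open>d\<close>-balls shrink at the boundary: from
  \<open>1 - d\<^sup>2 = (1 - \<bar>w\<bar>\<^sup>2) (1 - \<bar>z\<bar>\<^sup>2) / \<bar>1 - cnj w z\<bar>\<^sup>2\<close> one gets \<open>\<bar>1 - cnj w z\<bar>\<^sup>2 \<le> (1 - \<bar>w\<bar>\<^sup>2) / (1 - r\<^sup>2)\<close>,
  and the left-hand side dominates \<open>\<bar>z - w\<bar>\<^sup>2\<close>.
\<close>

lemma norm_diff_sq_le_if_pseudohyperbolic_dist_le:
  assumes w: "w \<in> unit_disc" and z: "z \<in> unit_disc"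
    and d: "pseudohyperbolic_dist w z \<le> r" and r: "r < 1"
  shows "(norm (z - w))\<^sup>2 \<le> (1 - (norm w)\<^sup>2) / (1 - r\<^sup>2)"
proof -
  define N where "N = (norm (1 - cnj w * z))\<^sup>2"
  have d0: "0 \<le> pseudohyperbolic_dist w z" by (simp add: pseudohyperbolic_dist_def)
  then have r2: "r\<^sup>2 < 1" using d r by (simp add: abs_square_less_1)
  have "norm (z - w) \<le> r * norm (1 - cnj w * z)"
    unfolding norm_diff_eq_pseudohyperbolic_dist[OF w z] using d by (simp add: mult_right_mono)
  then have le: "(norm (z - w))\<^sup>2 \<le> r\<^sup>2 * N"
    unfolding N_def by (metis norm_ge_zero power_mono power_mult_distrib)
  have "(1 - (norm w)\<^sup>2) * (1 - (norm z)\<^sup>2) \<le> (1 - (norm w)\<^sup>2) * 1"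
    using w by (intro mult_left_mono) (auto simp: abs_square_le_1)
  then have "(1 - r\<^sup>2) * N \<le> 1 - (norm w)\<^sup>2"
    using le norm_one_minus_cnj_mult_sq[of w z] by (simp add: N_def algebra_simps)
  then have "N \<le> (1 - (norm w)\<^sup>2) / (1 - r\<^sup>2)"
    using r2 by (simp add: field_simps)
  moreover have "r\<^sup>2 * N \<le> 1 * N"
    using r2 by (intro mult_right_mono) (auto simp: N_def)
  ultimately show ?thesis using le by simp
qed

text \<open>
  Points at \<open>d\<close>-distance at most \<open>r < 1\<close> from a sequence tending to a boundary point follow it to its limit,
  because the bound just obtained vanishes as \<open>\<bar>w\<bar> \<rightarrow> 1\<close>. The main proof needs this twice: with \<open>p\<close> the
  orbit of \<open>0\<close> under \<open>f\<close>, and with \<open>p\<close> the orbit of \<open>0\<close> under the perturbed composition.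
\<close>

lemma uniform_limit_if_pseudohyperbolically_close:
  assumes p: "\<And>n. p n \<in> unit_disc" and lim: "p \<longlonglongrightarrow> \<zeta>" and \<zeta>: "norm \<zeta> = 1"
    and r: "r < 1"
    and q: "\<And>n x. x \<in> K \<Longrightarrow> q n x \<in> pseudohyperbolic_cball (p n) r"
  shows "uniform_limit K q (\<lambda>_. \<zeta>) sequentially"
proof (rule uniform_limitI)
  fix e :: real assume "e > 0"
  define b where "b n = sqrt ((1 - (norm (p n))\<^sup>2) / (1 - r\<^sup>2)) + norm (p n - \<zeta>)" for n
  have "b \<longlonglongrightarrow> sqrt ((1 - (norm \<zeta>)\<^sup>2) / (1 - r\<^sup>2)) + norm (\<zeta> - \<zeta>)"
    unfolding b_def divide_inverse by (intro tendsto_intros lim)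
  then have "b \<longlonglongrightarrow> 0" using \<zeta> by simp
  then have "\<forall>\<^sub>F n in sequentially. b n < e"
    using \<open>e > 0\<close> by (simp add: order_tendstoD)
  then show "\<forall>\<^sub>F n in sequentially. \<forall>x\<in>K. dist (q n x) \<zeta> < e"
  proof eventually_elim
    case (elim n)
    show ?case
    proof
      fix x assume "x \<in> K"
      then have "norm (q n x - p n) \<le> sqrt ((1 - (norm (p n))\<^sup>2) / (1 - r\<^sup>2))"
        using q[of x n] p r
        by (intro real_le_rsqrt norm_diff_sq_le_if_pseudohyperbolic_dist_le)
          (auto simp: pseudohyperbolic_cball_def)
      moreover have "dist (q n x) \<zeta> \<le> norm (q n x - p n) + norm (p n - \<zeta>)"
        using dist_triangle[of "q n x" \<zeta> "p n"] by (simp add: dist_norm)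
      ultimately show "dist (q n x) \<zeta> < e" using elim by (simp add: b_def)
    qed
  qed
qed

section \<open>Perturbed iterates\<close>

lemma is_neighbourhood_hol_self_map_topology:
  assumes f: "f \<in> hol_self_maps" and K: "compact K" "K \<subseteq> unit_disc" and V: "open V"
    and fKV: "f ` K \<subseteq> V"
  shows "is_neighbourhood hol_self_map_topology f {g \<in> hol_self_maps. g ` K \<subseteq> V}"
proof -
  define T where "T = {g \<in> extensional unit_disc.
    continuous_map (top_of_set unit_disc) euclidean g \<and> g ` K \<subseteq> V}"
  have "openin (compact_open_topology (top_of_set unit_disc) euclidean) T"
    unfolding compact_open_topology_def T_def
  proof (rule topology_generated_by_Basis, rule CollectI, intro exI conjI)
    show "compactin (top_of_set unit_disc) K" using K by (simp add: compactin_subtopology)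
    show "openin euclidean V" using V by simp
  qed simp
  moreover have "{g \<in> hol_self_maps. g ` K \<subseteq> V} = T \<inter> hol_self_maps"
    by (auto simp: T_def hol_self_maps_def PiE_def holomorphic_on_imp_continuous_on)
  ultimately have "openin hol_self_map_topology {g \<in> hol_self_maps. g ` K \<subseteq> V}"
    unfolding hol_self_map_topology_def openin_subtopology by blast
  then show ?thesis
    using f fKV unfolding is_neighbourhood_def by (auto simp: topspace_hol_self_map_topology)
qed

lemma left_comp_hol_self_map:
  assumes "\<And>n. n \<ge> 1 \<Longrightarrow> g n \<in> hol_self_maps"
  shows "left_comp g n holomorphic_on unit_disc \<and> left_comp g n \<in> unit_disc \<rightarrow> unit_disc"
proof (induction n)
  case 0
  then show ?case by (auto simp: id_def)
next
  case (Suc n)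
  have "g (Suc n) holomorphic_on unit_disc" "g (Suc n) \<in> unit_disc \<rightarrow> unit_disc"
    using assms[of "Suc n"] by (auto simp: hol_self_maps_def)
  moreover from this Suc have "g (Suc n) \<circ> left_comp g n holomorphic_on unit_disc"
    by (intro holomorphic_on_compose_gen[of _ unit_disc _ unit_disc]) auto
  ultimately show ?case using Suc by (auto simp: Pi_iff o_def)
qed

theorem theorem4p1:
  fixes f :: "complex \<Rightarrow> complex" and \<zeta> :: complex
  assumes "f \<in> hol_self_maps"
    and "denjoy_wolff_point f \<zeta>"
    and "\<zeta> \<in> sphere 0 1"
  shows "\<exists>U :: nat \<Rightarrow> (complex \<Rightarrow> complex) set.
           (\<forall>n\<ge>1. is_neighbourhood hol_self_map_topology f (U n)) \<and>
           (\<forall>g :: nat \<Rightarrow> complex \<Rightarrow> complex.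
              (\<forall>n\<ge>1. g n \<in> U n) \<longrightarrow> converges_loc_unif_on_disc (left_comp g) \<zeta>)"
proof -
  have f: "f holomorphic_on unit_disc" "f \<in> unit_disc \<rightarrow> unit_disc"
    using assms(1) by (auto simp: hol_self_maps_def)
  have \<zeta>: "norm \<zeta> = 1" using assms(3) by simp
  define p where "p n = (f ^^ n) 0" for n
  have p_Suc: "p (Suc n) = f (p n)" for n by (simp add: p_def)
  have p: "p n \<in> unit_disc" for n
  proof (induction n)
    case (Suc n)
    then show ?case using f(2) unfolding p_Suc by blast
  qed (simp add: p_def)
  have p_lim: "p \<longlonglongrightarrow> \<zeta>"
    using assms(2) unfolding p_def denjoy_wolff_point_def converges_loc_unif_on_disc_def
    by (auto dest!: spec[of _ "{0}"])
  \<comment> \<open>Strict increase leaves room for the perturbation at every step; the common bound \<open>1/2\<close>, which could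
    be any number below \<open>1\<close>, keeps the accumulated error under control; \<open>r 0 = 0\<close> as both orbits
    start at \<open>0\<close>.\<close>
  define r :: "nat \<Rightarrow> real" where "r n = 1 / 2 - 1 / (real n + 2)" for n
  have r_less: "r n < r (Suc n)" for n by (simp add: r_def frac_less2)
  have r_le: "r n \<le> 1 / 2" for n by (simp add: r_def)
  have r_lt_1: "r n < 1" for n using r_le[of n] by simp
  define U where "U n = {g \<in> hol_self_maps.
    g ` pseudohyperbolic_cball (p (n - 1)) (r (n - 1)) \<subseteq> pseudohyperbolic_ball (p n) (r n)}" for n
  have "is_neighbourhood hol_self_map_topology f (U (Suc n))" for n
    unfolding U_def
  proof (intro is_neighbourhood_hol_self_map_topology assms(1) open_pseudohyperbolic_ball
      compact_pseudohyperbolic_cball p r_lt_1)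
    show "pseudohyperbolic_cball (p (Suc n - 1)) (r (Suc n - 1)) \<subseteq> unit_disc"
      by (auto simp: pseudohyperbolic_cball_def)
    show "f ` pseudohyperbolic_cball (p (Suc n - 1)) (r (Suc n - 1))
        \<subseteq> pseudohyperbolic_ball (p (Suc n)) (r (Suc n))"
    proof (rule image_subsetI)
      fix z assume "z \<in> pseudohyperbolic_cball (p (Suc n - 1)) (r (Suc n - 1))"
      then have z: "z \<in> unit_disc" "pseudohyperbolic_dist (p n) z \<le> r n"
        by (auto simp: pseudohyperbolic_cball_def)
      have "pseudohyperbolic_dist (f (p n)) (f z) \<le> pseudohyperbolic_dist (p n) z"
        using f p z by (intro Schwarz_Pick)
      also have "\<dots> < r (Suc n)" using z(2) r_less by (rule le_less_trans)
      finally show "f z \<in> pseudohyperbolic_ball (p (Suc n)) (r (Suc n))"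
        using f(2) z(1) unfolding pseudohyperbolic_ball_def p_Suc by blast
    qed
  qed
  then have nbhd: "is_neighbourhood hol_self_map_topology f (U n)" if "n \<ge> 1" for n
    using that by (metis Suc_le_D One_nat_def)
  have conv: "converges_loc_unif_on_disc (left_comp g) \<zeta>" if g: "\<forall>n\<ge>1. g n \<in> U n" for g
    unfolding converges_loc_unif_on_disc_def
  proof (intro allI impI, elim conjE)
    fix K assume K: "compact K" "K \<subseteq> unit_disc"
    define F where "F = left_comp g"
    have F: "F n holomorphic_on unit_disc" "F n \<in> unit_disc \<rightarrow> unit_disc" for n
      using left_comp_hol_self_map[of g n] g unfolding F_def U_def by auto
    have F_near_p: "F n 0 \<in> pseudohyperbolic_cball (p n) (r n)" for n
    proof (induction n)
      case 0
      then show ?case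
        by (simp add: F_def p_def r_def pseudohyperbolic_cball_def pseudohyperbolic_dist_def
            Moebius_function_eq_zero)
    next
      case (Suc n)
      have "g (Suc n) \<in> U (Suc n)" using g by simp
      with Suc have "g (Suc n) (F n 0) \<in> pseudohyperbolic_ball (p (Suc n)) (r (Suc n))"
        unfolding U_def by auto
      then show ?case
        by (simp add: F_def pseudohyperbolic_ball_def pseudohyperbolic_cball_def)
    qed
    have "uniform_limit {0} F (\<lambda>_. \<zeta>) sequentially"
    proof (rule uniform_limit_if_pseudohyperbolically_close[OF p p_lim \<zeta>])
      fix n and x :: complex assume "x \<in> {0}"
      then show "F n x \<in> pseudohyperbolic_cball (p n) (1 / 2)"
        using F_near_p[of n] r_le[of n] by (auto simp: pseudohyperbolic_cball_def)
    qed simp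
    then have F0_lim: "(\<lambda>n. F n 0) \<longlonglongrightarrow> \<zeta>"
      by (rule tendsto_uniform_limitI) simp
    obtain s where s: "s < 1" "\<And>z. z \<in> K \<Longrightarrow> norm z \<le> s"
    proof (cases "K = {}")
      case True
      then show ?thesis using that[of 0] by simp
    next
      case False
      then obtain z0 where "z0 \<in> K" "\<And>z. z \<in> K \<Longrightarrow> norm z \<le> norm z0"
        using continuous_attains_sup[OF K(1), of norm] continuous_on_norm_id by blast
      then show ?thesis using that[of "norm z0"] K(2) by auto
    qed
    have "uniform_limit K F (\<lambda>_. \<zeta>) sequentially"
    proof (rule uniform_limit_if_pseudohyperbolically_close[OF _ F0_lim \<zeta> s(1)])
      show F0: "F n 0 \<in> unit_disc" for n using F(2)[of n] by (auto simp: Pi_iff)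
      fix n z assume z: "z \<in> K"
      have "pseudohyperbolic_dist (F n 0) (F n z) \<le> pseudohyperbolic_dist 0 z"
        using F K(2) z by (intro Schwarz_Pick) auto
      also have "\<dots> \<le> s"
        using s(2)[OF z] by (simp add: pseudohyperbolic_dist_def Moebius_function_simple)
      finally show "F n z \<in> pseudohyperbolic_cball (F n 0) s"
        using F(2)[of n] K(2) z by (auto simp: pseudohyperbolic_cball_def Pi_iff)
    qed
    then show "uniform_limit K (left_comp g) (\<lambda>_. \<zeta>) sequentially" unfolding F_def .
  qed
  show ?thesis using nbhd conv by blast
qed

end
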